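(* Let $\mathcal C$ be a tensor category and $A,X\in\mathcal C$. Suppose that morphisms $m:A\otimes A\to A$, $m_X:A\otimes X\to X$, $\sigma:A\otimes A\to A\otimes A$ and $k:A\otimes X\to A\otimes X$ of $\mathcal C$ satisfy $$m_Xk=m_X,\qquad m\sigma=m,$$ $$k(m\otimes1_X)=(m\otimes1_X)a_{AAX}^{-1}(1_A\otimes k)a_{AAX}(\sigma\otimes1_X)a_{AAX}^{-1}(1_A\otimes k)a_{AAX},$$ $$k(1_A\otimes m_X)=(1_A\otimes m_X)a_{AAX}(\sigma\otimes1_X)a_{AAX}^{-1}(1_A\otimes k)a_{AAX}(\sigma\otimes1_X)a_{AAX}^{-1}.$$ If the pair $(m\otimes1_X,\,(1_A\otimes m_X)a_{AAX})$ of morphisms $(A\otimes A)\otimes X\to A\otimes X$ is monic, then $k$ is a solution to the reflection equation associated with $\sigma$: $$a_{AAX}^{-1}(1_A\otimes k)a_{AAX}(\sigma\otimes1_X)a_{AAX}^{-1}(1_A\otimes k)a_{AAX}(\sigma\otimes1_X)a_{AAX}^{-1}$$ $$=(\sigma\otimes1_X)a_{AAX}^{-1}(1_A\otimes k)a_{AAX}(\sigma\otimes1_X)a_{AAX}^{-1}(1_A\otimes k).$$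
   Context: A tensor category is a (not necessarily strict) monoidal category $(\mathcal C,\otimes,I,a,l,r)$ with associativity constraint $a_{UVW}:(U\otimes V)\otimes W\to U\otimes(V\otimes W)$ and unit constraints $l_V:I\otimes V\to V$, $r_V:V\otimes I\to V$, satisfying the pentagon and triangle axioms. Composition is written by juxtaposition. A pair of morphisms $(f:U\to V,\ g:U\to V)$ with the same source and target is called monic iff for all objects $W$ and morphisms $h,h':W\to U$, $fh=fh'$ and $gh=gh'$ imply $h=h'$. *)

theory Defs
  imports Main
begin

text \<open>The source and target of a morphism are part of the morphism, so distinct hom-sets are
  disjoint. Composition is in applicative order: \<open>g \<cdot> f\<close> is ``first \<open>f\<close>, then \<open>g\<close>'' and is
  meaningful only when \<open>Cod f = Dom g\<close>. The operations are constrained only on the objects and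
  morphisms of the category; their values elsewhere are irrelevant.\<close>

record ('o, 'm) category_data =
  Obj :: "'o set"
  Mor :: "'m set"
  Dom :: "'m \<Rightarrow> 'o"
  Cod :: "'m \<Rightarrow> 'o"
  Id :: "'o \<Rightarrow> 'm" (\<open>\<one>\<index>\<close>)
  Comp :: "'m \<Rightarrow> 'm \<Rightarrow> 'm" (infixr \<open>\<cdot>\<index>\<close> 70)

definition hom :: "('o, 'm, 'z) category_data_scheme \<Rightarrow> 'o \<Rightarrow> 'o \<Rightarrow> 'm set" where
  "hom C U V = {f \<in> Mor C. Dom C f = U \<and> Cod C f = V}"

locale category =
  fixes C :: "('o, 'm, 'z) category_data_scheme" (structure)
  assumes Dom_in_Obj: "f \<in> Mor C \<Longrightarrow> Dom C f \<in> Obj C"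
    and Cod_in_Obj: "f \<in> Mor C \<Longrightarrow> Cod C f \<in> Obj C"
    and Id_in_hom: "U \<in> Obj C \<Longrightarrow> \<one> U \<in> hom C U U"
    and Comp_in_hom: "\<lbrakk>f \<in> hom C U V; g \<in> hom C V W\<rbrakk> \<Longrightarrow> g \<cdot> f \<in> hom C U W"
    and Comp_Id_right: "f \<in> hom C U V \<Longrightarrow> f \<cdot> \<one> U = f"
    and Comp_Id_left: "f \<in> hom C U V \<Longrightarrow> \<one> V \<cdot> f = f"
    and Comp_assoc: "\<lbrakk>f \<in> hom C U V; g \<in> hom C V W; h \<in> hom C W Z\<rbrakk>
      \<Longrightarrow> (h \<cdot> g) \<cdot> f = h \<cdot> (g \<cdot> f)"

definition inverse_morphisms :: "('o, 'm, 'z) category_data_scheme \<Rightarrow> 'm \<Rightarrow> 'm \<Rightarrow> bool" where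
  "inverse_morphisms C f g \<longleftrightarrow>
     f \<in> Mor C \<and> g \<in> hom C (Cod C f) (Dom C f) \<and>
     Comp C g f = Id C (Dom C f) \<and> Comp C f g = Id C (Cod C f)"

definition iso :: "('o, 'm, 'z) category_data_scheme \<Rightarrow> 'm \<Rightarrow> bool" where
  "iso C f \<longleftrightarrow> (\<exists>g. inverse_morphisms C f g)"

definition inv_mor :: "('o, 'm, 'z) category_data_scheme \<Rightarrow> 'm \<Rightarrow> 'm"
    (\<open>inv\<index> _\<close> [81] 80) where
  "inv_mor C f = (THE g. inverse_morphisms C f g)"

text \<open>The tensor product is written \<open>\<otimes>\<close> on objects and \<open>\<boxtimes>\<close> on morphisms. The
  family \<open>\<a> U V W\<close> is the associativity constraint and \<open>\<l> V\<close>, \<open>\<r> V\<close> are the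
  left and right unit constraints.\<close>

record ('o, 'm) tensor_category_data = "('o, 'm) category_data" +
  TensorObj :: "'o \<Rightarrow> 'o \<Rightarrow> 'o" (infixr \<open>\<otimes>\<index>\<close> 75)
  TensorMor :: "'m \<Rightarrow> 'm \<Rightarrow> 'm" (infixr \<open>\<boxtimes>\<index>\<close> 75)
  UnitObj :: "'o" (\<open>\<I>\<index>\<close>)
  Assoc :: "'o \<Rightarrow> 'o \<Rightarrow> 'o \<Rightarrow> 'm" (\<open>\<a>\<index>\<close>)
  LUnit :: "'o \<Rightarrow> 'm" (\<open>\<l>\<index>\<close>)
  RUnit :: "'o \<Rightarrow> 'm" (\<open>\<r>\<index>\<close>)

locale tensor_category = category C
  for C :: "('o, 'm, 'z) tensor_category_data_scheme" (structure) +
  assumes TensorObj_in_Obj: "\<lbrakk>U \<in> Obj C; V \<in> Obj C\<rbrakk> \<Longrightarrow> U \<otimes> V \<in> Obj C"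
    and TensorMor_in_hom: "\<lbrakk>f \<in> hom C U V; g \<in> hom C U' V'\<rbrakk>
      \<Longrightarrow> f \<boxtimes> g \<in> hom C (U \<otimes> U') (V \<otimes> V')"
    and TensorMor_Id: "\<lbrakk>U \<in> Obj C; V \<in> Obj C\<rbrakk> \<Longrightarrow> \<one> U \<boxtimes> \<one> V = \<one> (U \<otimes> V)"
    and TensorMor_Comp:
      "\<lbrakk>f \<in> hom C U V; g \<in> hom C V W; f' \<in> hom C U' V'; g' \<in> hom C V' W'\<rbrakk>
      \<Longrightarrow> (g \<cdot> f) \<boxtimes> (g' \<cdot> f') = (g \<boxtimes> g') \<cdot> (f \<boxtimes> f')"
    and UnitObj_in_Obj: "\<I> \<in> Obj C"
    and Assoc_in_hom: "\<lbrakk>U \<in> Obj C; V \<in> Obj C; W \<in> Obj C\<rbrakk>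
      \<Longrightarrow> \<a> U V W \<in> hom C ((U \<otimes> V) \<otimes> W) (U \<otimes> (V \<otimes> W))"
    and Assoc_iso: "\<lbrakk>U \<in> Obj C; V \<in> Obj C; W \<in> Obj C\<rbrakk> \<Longrightarrow> iso C (\<a> U V W)"
    and Assoc_natural: "\<lbrakk>f \<in> hom C U U'; g \<in> hom C V V'; h \<in> hom C W W'\<rbrakk>
      \<Longrightarrow> \<a> U' V' W' \<cdot> ((f \<boxtimes> g) \<boxtimes> h) = (f \<boxtimes> (g \<boxtimes> h)) \<cdot> \<a> U V W"
    and LUnit_in_hom: "V \<in> Obj C \<Longrightarrow> \<l> V \<in> hom C (\<I> \<otimes> V) V"
    and LUnit_iso: "V \<in> Obj C \<Longrightarrow> iso C (\<l> V)"
    and LUnit_natural: "f \<in> hom C U V \<Longrightarrow> \<l> V \<cdot> (\<one> \<I> \<boxtimes> f) = f \<cdot> \<l> U"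
    and RUnit_in_hom: "V \<in> Obj C \<Longrightarrow> \<r> V \<in> hom C (V \<otimes> \<I>) V"
    and RUnit_iso: "V \<in> Obj C \<Longrightarrow> iso C (\<r> V)"
    and RUnit_natural: "f \<in> hom C U V \<Longrightarrow> \<r> V \<cdot> (f \<boxtimes> \<one> \<I>) = f \<cdot> \<r> U"
    and pentagon: "\<lbrakk>U \<in> Obj C; V \<in> Obj C; W \<in> Obj C; Z \<in> Obj C\<rbrakk>
      \<Longrightarrow> (\<one> U \<boxtimes> \<a> V W Z) \<cdot> \<a> U (V \<otimes> W) Z \<cdot> (\<a> U V W \<boxtimes> \<one> Z)
        = \<a> U V (W \<otimes> Z) \<cdot> \<a> (U \<otimes> V) W Z"
    and triangle: "\<lbrakk>V \<in> Obj C; W \<in> Obj C\<rbrakk>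
      \<Longrightarrow> (\<one> V \<boxtimes> \<l> W) \<cdot> \<a> V \<I> W = \<r> V \<boxtimes> \<one> W"

definition monic_pair ::
    "('o, 'm, 'z) category_data_scheme \<Rightarrow> 'o \<Rightarrow> 'o \<Rightarrow> 'm \<Rightarrow> 'm \<Rightarrow> bool" where
  "monic_pair C U V f g \<longleftrightarrow>
     f \<in> hom C U V \<and> g \<in> hom C U V \<and>
     (\<forall>W \<in> Obj C. \<forall>h \<in> hom C W U. \<forall>h' \<in> hom C W U.
        Comp C f h = Comp C f h' \<longrightarrow> Comp C g h = Comp C g h' \<longrightarrow> h = h')"

end

theory Submission
  imports Defs
begin

text \<open>Put \<open>P = (A \<otimes> A) \<otimes> X\<close> and, on \<open>P\<close>, let \<open>S = \<sigma> \<boxtimes> \<one> X\<close> and let \<open>K\<close> be the conjugate of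
  \<open>\<one> A \<boxtimes> k\<close> by the associator; let \<open>M = m \<boxtimes> \<one> X\<close> and \<open>N = (\<one> A \<boxtimes> m\<^sub>X) \<cdot> \<a> A A X\<close>.
  The hypotheses become \<open>M S = M\<close>, \<open>N K = N\<close>, \<open>k M = M K S K\<close> and \<open>k N = N S K S\<close>. Hence
  \<open>M\<close> sends both \<open>K S K S\<close> and \<open>S K S K\<close> to \<open>k M\<close>, and \<open>N\<close> sends both to \<open>k N\<close>, so the two
  endomorphisms of \<open>P\<close> coincide.\<close>

text \<open>Since \<open>inv\<close> is a definite description, it has these properties only once
  the inverse is known to be unique: two inverses \<open>g\<close> and \<open>h\<close> of
  \<open>f\<close> agree because both equal \<open>g \<cdot> f \<cdot> h\<close>.\<close>

lemma (in category) inv_morI: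
  assumes "iso C f" "f \<in> hom C U V"
  shows "inv f \<in> hom C V U" "inv f \<cdot> f = \<one> U" "f \<cdot> inv f = \<one> V"
proof -
  have f: "f \<in> Mor C" "Dom C f = U" "Cod C f = V"
    using assms(2) by (auto simp: hom_def)
  have unique: "g = h" if "inverse_morphisms C f g" "inverse_morphisms C f h" for g h
  proof -
    have g: "g \<in> hom C V U" "g \<cdot> f = \<one> U" and h: "h \<in> hom C V U" "f \<cdot> h = \<one> V"
      using that f by (auto simp: inverse_morphisms_def)
    have "g = g \<cdot> (f \<cdot> h)"
      using Comp_Id_right[OF g(1)] h(2) by simp
    also have "\<dots> = h"
      using Comp_assoc[OF h(1) assms(2) g(1)] Comp_Id_left[OF h(1)] g(2) by simp
    finally show ?thesis .
  qed
  obtain g where "inverse_morphisms C f g"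
    using assms(1) by (auto simp: iso_def)
  then have "inverse_morphisms C f (inv f)"
    unfolding inv_mor_def by (metis theI unique)
  then show "inv f \<in> hom C V U" "inv f \<cdot> f = \<one> U" "f \<cdot> inv f = \<one> V"
    using f by (auto simp: inverse_morphisms_def)
qed

text \<open>The cancellation argument, for endomorphisms \<open>S\<close> and \<open>K\<close> of
  one object in any category. Isolating it keeps associators and tensor products out of the
  computation.\<close>

lemma (in category) monic_pair_reflection:
  assumes monic: "monic_pair C P Q M N"
    and S: "S \<in> hom C P P" and K: "K \<in> hom C P P" and k: "k \<in> hom C Q Q"
    and MS: "M \<cdot> S = M" and NK: "N \<cdot> K = N"
    and kM: "k \<cdot> M = M \<cdot> K \<cdot> S \<cdot> K"
    and kN: "k \<cdot> N = N \<cdot> S \<cdot> K \<cdot> S"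
  shows "K \<cdot> S \<cdot> K \<cdot> S = S \<cdot> K \<cdot> S \<cdot> K"
proof -
  have M: "M \<in> hom C P Q" and N: "N \<in> hom C P Q"
    using monic by (auto simp: monic_pair_def)
  have P: "P \<in> Obj C"
    using S Dom_in_Obj by (auto simp: hom_def)
  note SK = Comp_in_hom[OF K S] and KS = Comp_in_hom[OF S K]
  note KSK = Comp_in_hom[OF SK K] and SKS = Comp_in_hom[OF KS S]
  note KSKS = Comp_in_hom[OF SKS K] and SKSK = Comp_in_hom[OF KSK S]
  have "M \<cdot> K \<cdot> S \<cdot> K \<cdot> S = (M \<cdot> K \<cdot> S \<cdot> K) \<cdot> S"
    using Comp_assoc[OF S KSK M] Comp_assoc[OF S SK K] Comp_assoc[OF S K S] by simp
  \<comment> \<open>\<open>k \<cdot> M\<close> absorbs the trailing \<open>S\<close>; the next step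
    then releases an \<open>S\<close> directly after \<open>M\<close>.\<close>
  also have "\<dots> = k \<cdot> M"
    using Comp_assoc[OF S M k] kM MS by simp
  also have "\<dots> = M \<cdot> S \<cdot> K \<cdot> S \<cdot> K"
    using Comp_assoc[OF KSK S M] kM MS by simp
  finally have 1: "M \<cdot> K \<cdot> S \<cdot> K \<cdot> S = M \<cdot> S \<cdot> K \<cdot> S \<cdot> K" .
  \<comment> \<open>In mirror image, \<open>N\<close> absorbs the leading \<open>K\<close>, and
    \<open>k \<cdot> N\<close> then releases a trailing one.\<close>
  have "N \<cdot> K \<cdot> S \<cdot> K \<cdot> S = k \<cdot> N"
    using Comp_assoc[OF SKS K N] kN NK by simp
  also have "\<dots> = (N \<cdot> S \<cdot> K \<cdot> S) \<cdot> K"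
    using Comp_assoc[OF K N k] kN NK by simp
  also have "\<dots> = N \<cdot> S \<cdot> K \<cdot> S \<cdot> K"
    using Comp_assoc[OF K SKS N] Comp_assoc[OF K KS S] Comp_assoc[OF K S K] by simp
  finally have 2: "N \<cdot> K \<cdot> S \<cdot> K \<cdot> S = N \<cdot> S \<cdot> K \<cdot> S \<cdot> K" .
  show ?thesis
    using monic P KSKS SKSK 1 2 unfolding monic_pair_def by blast
qed

theorem corollary3p5:
  fixes C :: "('o, 'm, 'z) tensor_category_data_scheme" (structure)
    and A X :: 'o
    and m m\<^sub>X \<sigma> k :: 'm
  assumes "tensor_category C"
    and "A \<in> Obj C" and "X \<in> Obj C"
    and "m \<in> hom C (A \<otimes> A) A"
    and "m\<^sub>X \<in> hom C (A \<otimes> X) X"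
    and "\<sigma> \<in> hom C (A \<otimes> A) (A \<otimes> A)"
    and "k \<in> hom C (A \<otimes> X) (A \<otimes> X)"
    and "m\<^sub>X \<cdot> k = m\<^sub>X"
    and "m \<cdot> \<sigma> = m"
    and "k \<cdot> (m \<boxtimes> \<one> X) =
      (m \<boxtimes> \<one> X) \<cdot> inv (\<a> A A X) \<cdot> (\<one> A \<boxtimes> k) \<cdot> \<a> A A X \<cdot> (\<sigma> \<boxtimes> \<one> X)
        \<cdot> inv (\<a> A A X) \<cdot> (\<one> A \<boxtimes> k) \<cdot> \<a> A A X"
    and "k \<cdot> (\<one> A \<boxtimes> m\<^sub>X) =
      (\<one> A \<boxtimes> m\<^sub>X) \<cdot> \<a> A A X \<cdot> (\<sigma> \<boxtimes> \<one> X) \<cdot> inv (\<a> A A X) \<cdot> (\<one> A \<boxtimes> k)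
        \<cdot> \<a> A A X \<cdot> (\<sigma> \<boxtimes> \<one> X) \<cdot> inv (\<a> A A X)"
    and "monic_pair C ((A \<otimes> A) \<otimes> X) (A \<otimes> X)
      (m \<boxtimes> \<one> X) ((\<one> A \<boxtimes> m\<^sub>X) \<cdot> \<a> A A X)"
  shows "inv (\<a> A A X) \<cdot> (\<one> A \<boxtimes> k) \<cdot> \<a> A A X \<cdot> (\<sigma> \<boxtimes> \<one> X)
        \<cdot> inv (\<a> A A X) \<cdot> (\<one> A \<boxtimes> k) \<cdot> \<a> A A X \<cdot> (\<sigma> \<boxtimes> \<one> X) \<cdot> inv (\<a> A A X)
    = (\<sigma> \<boxtimes> \<one> X) \<cdot> inv (\<a> A A X) \<cdot> (\<one> A \<boxtimes> k) \<cdot> \<a> A A X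
        \<cdot> (\<sigma> \<boxtimes> \<one> X) \<cdot> inv (\<a> A A X) \<cdot> (\<one> A \<boxtimes> k)"
proof -
  interpret tensor_category C by fact
  note A = \<open>A \<in> Obj C\<close> and X = \<open>X \<in> Obj C\<close>
  note m = \<open>m \<in> hom C (A \<otimes> A) A\<close> and mX = \<open>m\<^sub>X \<in> hom C (A \<otimes> X) X\<close>
  note sigma = \<open>\<sigma> \<in> hom C (A \<otimes> A) (A \<otimes> A)\<close> and k = \<open>k \<in> hom C (A \<otimes> X) (A \<otimes> X)\<close>
  note monic = \<open>monic_pair C _ _ _ _\<close>
  let ?P = "(A \<otimes> A) \<otimes> X" and ?R = "A \<otimes> (A \<otimes> X)"
  define a where "a = \<a> A A X"
  define b where "b = inv (\<a> A A X)"
  define T where "T = \<one> A \<boxtimes> k"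
  define S where "S = \<sigma> \<boxtimes> \<one> X"
  define M where "M = m \<boxtimes> \<one> X"
  define n where "n = \<one> A \<boxtimes> m\<^sub>X"
  note defs = a_def b_def T_def S_def M_def n_def
  have a: "a \<in> hom C ?P ?R"
    unfolding a_def using A X by (intro Assoc_in_hom)
  have "iso C a"
    unfolding a_def using A X by (intro Assoc_iso)
  \<comment> \<open>Unfolding \<open>a\<close> exposes \<open>inv (\<a> A A X)\<close>, which is
    folded to \<open>b\<close> before \<open>a\<close> is restored.\<close>
  note b_props = inv_morI[OF this a, unfolded a_def, folded b_def, folded a_def]
  note b = b_props(1) and ba = b_props(2) and ab = b_props(3)
  have T: "T \<in> hom C ?R ?R" and S: "S \<in> hom C ?P ?P"
    and M: "M \<in> hom C ?P (A \<otimes> X)" and n: "n \<in> hom C ?R (A \<otimes> X)"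
    unfolding defs using A X m mX sigma k by (auto intro: TensorMor_in_hom Id_in_hom)
  \<comment> \<open>The objects in \<open>Comp_assoc\<close> occur only in its premises, where
    rewriting cannot instantiate them; phrased with \<open>Dom\<close> and \<open>Cod\<close>, the
    side conditions can be settled by rewriting.\<close>
  have assoc: "(h \<cdot> g) \<cdot> f = h \<cdot> g \<cdot> f"
    if "f \<in> Mor C" "g \<in> Mor C" "h \<in> Mor C" "Cod C f = Dom C g" "Cod C g = Dom C h" for f g h
    using that Comp_assoc by (simp add: hom_def)
  have comp: "g \<cdot> f \<in> Mor C \<and> Dom C (g \<cdot> f) = Dom C f \<and> Cod C (g \<cdot> f) = Cod C g"
    if "f \<in> Mor C" "g \<in> Mor C" "Cod C f = Dom C g" for f g
    using that Comp_in_hom[of f "Dom C f" "Dom C g" g "Cod C g"] by (simp add: hom_def)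
  note types = a[unfolded hom_def, simplified] b[unfolded hom_def, simplified]
    T[unfolded hom_def, simplified] S[unfolded hom_def, simplified]
    M[unfolded hom_def, simplified] n[unfolded hom_def, simplified]
    k[unfolded hom_def, simplified]
  note assoc_simps = assoc comp types
  define K where "K = b \<cdot> T \<cdot> a"
  have K: "K \<in> hom C ?P ?P"
    unfolding K_def by (rule Comp_in_hom[OF Comp_in_hom[OF a T] b])
  \<comment> \<open>\<open>a\<close> intertwines \<open>K\<close> with \<open>T\<close>, which
    reduces the later \<open>NK\<close> to \<open>nT\<close>.\<close>
  have aK: "a \<cdot> K = T \<cdot> a"
  proof -
    have "a \<cdot> K = (a \<cdot> b) \<cdot> T \<cdot> a"
      unfolding K_def by (simp add: assoc_simps)
    then show ?thesis
      using ab Comp_Id_left[OF Comp_in_hom[OF a T]] by simp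
  qed
  have MS: "M \<cdot> S = M"
    unfolding defs
    using TensorMor_Comp[OF sigma m Id_in_hom[OF X] Id_in_hom[OF X]]
      Comp_Id_left[OF Id_in_hom[OF X]] \<open>m \<cdot> \<sigma> = m\<close> by simp
  have nT: "n \<cdot> T = n"
    unfolding defs
    using TensorMor_Comp[OF Id_in_hom[OF A] Id_in_hom[OF A] k mX]
      Comp_Id_left[OF Id_in_hom[OF A]] \<open>m\<^sub>X \<cdot> k = m\<^sub>X\<close> by simp
  have NK: "(n \<cdot> a) \<cdot> K = n \<cdot> a"
    using Comp_assoc[OF K a n] aK Comp_assoc[OF a T n] nT by simp
  have kM: "k \<cdot> M = M \<cdot> K \<cdot> S \<cdot> K"
    using \<open>k \<cdot> (m \<boxtimes> \<one> X) = _\<close>[folded defs] unfolding K_def by (simp add: assoc_simps)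
  \<comment> \<open>This hypothesis concerns morphisms out of \<open>?R\<close>. Composing with
    \<open>a\<close> on the right moves it to \<open>?P\<close>, where the trailing \<open>b\<close>
    cancels.\<close>
  have "k \<cdot> n = ((n \<cdot> a) \<cdot> S \<cdot> K \<cdot> S) \<cdot> b"
    using \<open>k \<cdot> (\<one> A \<boxtimes> m\<^sub>X) = _\<close>[folded defs] unfolding K_def by (simp add: assoc_simps)
  then have "k \<cdot> n \<cdot> a = ((n \<cdot> a) \<cdot> S \<cdot> K \<cdot> S) \<cdot> b \<cdot> a"
    using Comp_assoc[OF a n k] unfolding K_def by (simp add: assoc_simps)
  also have "\<dots> = (n \<cdot> a) \<cdot> S \<cdot> K \<cdot> S"
    unfolding ba
    by (rule Comp_Id_right[OF Comp_in_hom[OF Comp_in_hom[OF Comp_in_hom[OF S K] S]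
          Comp_in_hom[OF a n]]])
  finally have kN: "k \<cdot> n \<cdot> a = (n \<cdot> a) \<cdot> S \<cdot> K \<cdot> S" .
  have reflection: "K \<cdot> S \<cdot> K \<cdot> S = S \<cdot> K \<cdot> S \<cdot> K"
    by (rule monic_pair_reflection[OF monic[folded defs] S K k MS NK kM kN])
  have Kb: "K \<cdot> b = b \<cdot> T"
  proof -
    have "K \<cdot> b = (b \<cdot> T) \<cdot> a \<cdot> b"
      unfolding K_def by (simp add: assoc_simps)
    then show ?thesis
      using ab Comp_Id_right[OF Comp_in_hom[OF T b]] by simp
  qed
  \<comment> \<open>The goal equates morphisms from \<open>?R\<close> to \<open>?P\<close>, so
    \<open>reflection\<close> is composed with \<open>b\<close> on the right. The left side then
    matches once \<open>K\<close> is unfolded; on the right side, \<open>Kb\<close> turns the final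
    \<open>K \<cdot> b\<close> into \<open>b \<cdot> T\<close>.\<close>
  have "b \<cdot> T \<cdot> a \<cdot> S \<cdot> b \<cdot> T \<cdot> a \<cdot> S \<cdot> b = (K \<cdot> S \<cdot> K \<cdot> S) \<cdot> b"
    unfolding K_def by (simp add: assoc_simps)
  also have "\<dots> = (S \<cdot> K \<cdot> S) \<cdot> K \<cdot> b"
    unfolding reflection using K by (simp add: assoc_simps hom_def)
  also have "\<dots> = S \<cdot> b \<cdot> T \<cdot> a \<cdot> S \<cdot> b \<cdot> T"
    unfolding Kb unfolding K_def by (simp add: assoc_simps)
  finally show ?thesis
    unfolding defs .
qed

end
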